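(* Let $0<\alpha\le 1$ and let $\{\mathcal{N}^{\alpha}_{c}(t)\}_{t\ge 0}$ be the convoluted fractional Poisson process with intensity parameters $\{\lambda_j\}_{j\in\mathbb{Z}}$ (so $\lambda_{-1}=0$). For every integer $r\ge 1$ and $t\ge 0$, the $r$th moment $\mu^{\alpha}_{c}(r,t)=\mathbb{E}\big((\mathcal{N}^{\alpha}_{c}(t))^r\big)$ is given by $$\mu^{\alpha}_{c}(r,t)=r!\sum_{k=1}^{r}\frac{t^{k\alpha}}{\Gamma(k\alpha+1)}\sum_{\substack{m_1+\cdots+m_k=r\\ m_j\in\mathbb{N}_0}}\ \prod_{\ell=1}^{k}\left(\frac{1}{m_\ell!}\sum_{j=0}^{\infty}j^{m_\ell}(\lambda_{j-1}-\lambda_{j})\right).$$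
   Context: $\mathbb{N}_0$ denotes the non-negative integers; $0^0=1$. Intensity parameters: $\{\lambda_j\}_{j\in\mathbb{Z}}$ are real numbers with $\lambda_j=0$ for $j<0$, $\lambda_0>0$, $\lambda_j\ge 0$ for $j>0$, non-increasing for $j\ge 0$, and $\lim_{j\to\infty}\lambda_{j+1}/\lambda_j<1$ (this limit condition is regarded as satisfied if $\lambda_j=0$ for all large $j$). Fractional derivative (Dzhrbashyan–Caputo): $\partial_t^{\alpha}f(t)=\frac{1}{\Gamma(1-\alpha)}\int_0^t (t-s)^{-\alpha}f'(s)\,\mathrm{d}s$ for $0<\alpha<1$, and $\partial_t^{1}f(t)=f'(t)$. Convoluted fractional Poisson process (CFPP): an $\mathbb{N}_0$-valued stochastic process $\{\mathcal{N}^{\alpha}_{c}(t)\}_{t\ge0}$ whose state probabilities $p^{\alpha}_{c}(n,t)=\Pr\{\mathcal{N}^{\alpha}_{c}(t)=n\}$ satisfy, for all $n\ge 0$, $$\partial_t^{\alpha}p^{\alpha}_{c}(n,t)=-\lambda_n * p^{\alpha}_{c}(n,t)+\lambda_{n-1}*p^{\alpha}_{c}(n-1,t),$$ where $\lambda_n*p^{\alpha}_{c}(n,t)=\sum_{j=-\infty}^{\infty}\lambda_j p^{\alpha}_{c}(n-j,t)$ is the discrete convolution in the space variable, with $p^{\alpha}_{c}(0,0)=1$, $p^{\alpha}_{c}(n,0)=0$ for $n\ge 1$, and $p^{\alpha}_{c}(-n,t)=0$ for $n\ge 1$, $t\ge 0$. Equivalently, $\partial_t^{\alpha}p^{\alpha}_{c}(n,t)=-\lambda_0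 p^{\alpha}_{c}(n,t)+\sum_{j=1}^{n}(\lambda_{j-1}-\lambda_j)p^{\alpha}_{c}(n-j,t)$. *)

theory Defs
  imports "HOL-Probability.Probability"
begin

text \<open>
  The quotient condition is regarded as satisfied when the sequence vanishes eventually.
\<close>

definition intensity_parameters :: "(int \<Rightarrow> real) \<Rightarrow> bool" where
  "intensity_parameters lam \<longleftrightarrow>
     (\<forall>j<0. lam j = 0) \<and> lam 0 > 0 \<and> (\<forall>j>0. lam j \<ge> 0) \<and>
     (\<forall>i j. 0 \<le> i \<longrightarrow> i \<le> j \<longrightarrow> lam j \<le> lam i) \<and>
     ((\<exists>L<1. (\<lambda>j::nat. lam (int j + 1) / lam (int j)) \<longlonglongrightarrow> L) \<or>
      (\<forall>\<^sub>F j::nat in sequentially. lam (int j) = 0))"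

text \<open>
  The Dzhrbashyan--Caputo derivative at \<open>t > 0\<close>, for \<open>0 < \<alpha> \<le> 1\<close>.  It is meaningful under
  \<open>caputo_differentiable\<close>.  Continuity on the closed half-line is part of that condition because
  the integral only sees \<open>f'\<close> on \<open>(0, t)\<close>: without it the value \<open>f 0\<close>, and hence an initial
  condition, would be unrelated to \<open>f\<close> on \<open>(0, \<infinity>)\<close>.  Differentiability at \<open>0\<close> is not required,
  as \<open>f'\<close> is typically unbounded near \<open>0\<close> when \<open>\<alpha> < 1\<close>.
\<close>

definition caputo_deriv :: "real \<Rightarrow> (real \<Rightarrow> real) \<Rightarrow> real \<Rightarrow> real" where
  "caputo_deriv \<alpha> f t =
     (if \<alpha> = 1 then deriv f t
      else 1 / Gamma (1 - \<alpha>) * (LBINT s:{0<..<t}. (t - s) powr (- \<alpha>) * deriv f s))"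

definition caputo_differentiable :: "real \<Rightarrow> (real \<Rightarrow> real) \<Rightarrow> bool" where
  "caputo_differentiable \<alpha> f \<longleftrightarrow>
     continuous_on {0..} f \<and>
     (\<forall>t>0. f differentiable (at t)) \<and>
     (\<alpha> < 1 \<longrightarrow> (\<forall>t>0. set_integrable lborel {0<..<t} (\<lambda>s. (t - s) powr (- \<alpha>) * deriv f s)))"

definition discrete_conv :: "(int \<Rightarrow> real) \<Rightarrow> (int \<Rightarrow> real) \<Rightarrow> int \<Rightarrow> real" where
  "discrete_conv a b n = (\<Sum>\<^sub>\<infinity>j. a j * b (n - j))"

definition state_prob :: "'a measure \<Rightarrow> (real \<Rightarrow> 'a \<Rightarrow> nat) \<Rightarrow> int \<Rightarrow> real \<Rightarrow> real" where
  "state_prob M N n t = measure M {\<omega> \<in> space M. int (N t \<omega>) = n}"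

text \<open>
  States are indexed by integers so that the convolution over all of \<open>\<int>\<close> can be written down.
  The evolution equation is imposed for \<open>t > 0\<close>; at \<open>t = 0\<close> the fractional integral is
  an integral over the empty interval.
\<close>

locale convoluted_fractional_poisson = prob_space M
  for M :: "'a measure" and \<alpha> :: real and lam :: "int \<Rightarrow> real" and N :: "real \<Rightarrow> 'a \<Rightarrow> nat" +
  assumes order: "0 < \<alpha>" "\<alpha> \<le> 1"
    and intensity: "intensity_parameters lam"
    and random_variable: "\<And>t. t \<ge> 0 \<Longrightarrow> N t \<in> measurable M (count_space UNIV)"
    and regular: "\<And>n. n \<ge> 0 \<Longrightarrow> caputo_differentiable \<alpha> (state_prob M N n)"
    and evolution: "\<And>n t. n \<ge> 0 \<Longrightarrow> t > 0 \<Longrightarrow>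
      caputo_deriv \<alpha> (state_prob M N n) t =
        - discrete_conv lam (\<lambda>m. state_prob M N m t) n
        + discrete_conv lam (\<lambda>m. state_prob M N m t) (n - 1)"
    and initial_zero: "state_prob M N 0 0 = 1"
    and initial_pos: "\<And>n. n \<ge> 1 \<Longrightarrow> state_prob M N n 0 = 0"
    and negative: "\<And>n t. n \<ge> 1 \<Longrightarrow> t \<ge> 0 \<Longrightarrow> state_prob M N (- n) t = 0"

end

theory Submission imports Defs begin

text \<open>
  Put \<open>a j = \<lambda> (j - 1) - \<lambda> j\<close>.  The evolution equation is
  \<open>\<partial>\<^sup>\<alpha> p n = (\<Sum>j\<le>n. a j * p (n - j))\<close>.  Applying the Riemann--Liouville integral of order
  \<open>\<alpha>\<close> (here \<open>frac_int\<close>) turns it into an integral equation, whose Picard iteration gives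
  \<open>p n t = (\<Sum>k. c k n * t powr (k \<alpha>) / Gamma (k \<alpha> + 1))\<close>, where \<open>c k n\<close> is the coefficient of
  \<open>z\<^sup>n\<close> in the \<open>k\<close>-th power of the formal power series \<open>\<Sum>j. a j * z\<^sup>j\<close>.  The limit condition on the
  intensities makes \<open>\<Sum>j. \<bar>a j\<bar> * w\<^sup>j\<close> finite for some \<open>w > 1\<close>, say equal to \<open>B\<close>; hence
  \<open>\<Sum>n. n\<^sup>r * \<bar>c k n\<bar>\<close> is at most a constant multiple of \<open>B\<^sup>k\<close>, and the moments may be computed term by
  term in \<open>k\<close>.  The series \<open>\<Sum>r. (\<Sum>n. n\<^sup>r * c n) * x\<^sup>r / r!\<close> is multiplicative under convolution of the
  sequences \<open>c\<close>, which produces the sum over compositions of \<open>r\<close>; since \<open>\<Sum>j. a j = 0\<close>, only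
  \<open>k \<le> r\<close> contributes.
\<close>

section \<open>Riemann--Liouville integrals\<close>

definition frac_int :: "real \<Rightarrow> (real \<Rightarrow> real) \<Rightarrow> real \<Rightarrow> real" where
  "frac_int a f t = 1 / Gamma a * (LBINT s:{0<..<t}. (t - s) powr (a - 1) * f s)"

text \<open>The substitution u = s + (t - s) x reduces this to Euler's Beta integral. It serves both
  the fractional integrals of powers (s = 0) and the inner integral in the inversion of the Caputo
  derivative.\<close>

lemma has_bochner_integral_beta_kernel:
  fixes a b s t :: real
  assumes "a > 0" "b > 0" "s < t"
  shows "has_bochner_integral lborel
    (\<lambda>u. indicator {s<..<t} u * ((t - u) powr (a - 1) * (u - s) powr (b - 1)))
    ((t - s) powr (a + b - 1) * Beta a b)"
proof -
  let ?f = "\<lambda>u. indicator {s<..<t} u * ((t - u) powr (a - 1) * (u - s) powr (b - 1))"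
  let ?g = "\<lambda>x::real. x powr (b - 1) * (1 - x) powr (a - 1)"
  have int: "set_integrable lborel {0..1} ?g"
    using integrable_Beta[of b a] assms by simp
  have "integral {0..1} ?g = Beta b a"
    using has_integral_Beta_real[of b a] assms by (simp add: integral_unique)
  then have "has_bochner_integral lborel (\<lambda>x. indicator {0..1} x * ?g x) (Beta a b)"
    using int set_borel_integral_eq_integral(2)[OF int]
    by (simp add: has_bochner_integral_iff set_integrable_def set_lebesgue_integral_def Beta_commute)
  then have "has_bochner_integral lborel
      (\<lambda>x. (t - s) powr (a + b - 2) * (indicator {0..1} x * ?g x))
      ((t - s) powr (a + b - 2) * Beta a b)"
    by (rule has_bochner_integral_mult_right)
  also have "(\<lambda>x. (t - s) powr (a + b - 2) * (indicator {0..1} x * ?g x)) = (\<lambda>x. ?f (s + (t - s) * x))"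
  proof
    fix x :: real
    \<comment> \<open>At the end points the closed and the open interval agree because
      \<open>0 powr y = 0\<close>.\<close>
    consider "x < 0" | "x = 0" | "x > 0" "x < 1" | "x = 1" | "x > 1" by linarith
    then show "(t - s) powr (a + b - 2) * (indicator {0..1} x * ?g x) = ?f (s + (t - s) * x)"
    proof cases
      case 1
      then have "(t - s) * x < 0" using assms by (intro mult_pos_neg) auto
      then show ?thesis using 1 by simp
    next
      case 3
      have "(t - s) * x < (t - s) * 1"
        using assms 3 by (intro mult_strict_left_mono) auto
      then have "s + (t - s) * x < t" by (simp add: algebra_simps)
      then have "indicator {s<..<t} (s + (t - s) * x) = (1 :: real)"
        using assms 3 by (simp add: indicator_def)
      moreover have "t - (s + (t - s) * x) = (t - s) * (1 - x)" by (simp add: algebra_simps)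
      moreover have "(t - s) powr (a + b - 2) = (t - s) powr (a - 1) * (t - s) powr (b - 1)"
        by (simp flip: powr_add add: algebra_simps)
      ultimately show ?thesis using assms 3 by (simp add: powr_mult)
    next
      case 5
      then have "(t - s) * x > t - s" using assms by auto
      then show ?thesis using 5 by simp
    qed auto
  qed
  \<comment> \<open>The two factors contribute the exponent a + b - 2; the missing power of t - s is
    the Jacobian.\<close>
  also have "(t - s) powr (a + b - 2) * Beta a b = ((t - s) powr (a + b - 1) * Beta a b) /\<^sub>R \<bar>t - s\<bar>"
  proof -
    have "(t - s) powr (a + b - 1) = (t - s) powr (a + b - 2) * (t - s)"
      using assms powr_add[of "t - s" "a + b - 2" 1] by (simp add: algebra_simps)
    then show ?thesis using assms by simp
  qed
  finally show ?thesis
    using assms by (subst lborel_has_bochner_integral_real_affine_iff[where c = "t - s" and t = s]) auto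
qed

lemma set_integrable_beta_kernel:
  fixes a b s t :: real
  assumes "a > 0" "b > 0" "s < t"
  shows "set_integrable lborel {s<..<t} (\<lambda>u. (t - u) powr (a - 1) * (u - s) powr (b - 1))"
    and "(LBINT u:{s<..<t}. (t - u) powr (a - 1) * (u - s) powr (b - 1)) =
           (t - s) powr (a + b - 1) * Beta a b"
  using has_bochner_integral_beta_kernel[OF assms]
  by (auto simp: set_integrable_def set_lebesgue_integral_def has_bochner_integral_iff)

lemma frac_int_powr:
  assumes "a > 0" "b > -1" "t > 0"
  shows "frac_int a (\<lambda>s. s powr b) t = Gamma (b + 1) / Gamma (a + b + 1) * t powr (a + b)"
  using set_integrable_beta_kernel(2)[of a "b + 1" 0 t] assms less_imp_neq[OF Gamma_real_pos[of a]]
  by (simp add: frac_int_def Beta_def algebra_simps)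

text \<open>A continuous function is bounded on the compact interval, so a multiple of the Beta
  kernel with b = 1 dominates; its second factor is 1 on the open interval.\<close>

lemma set_integrable_frac_kernel:
  fixes f :: "real \<Rightarrow> real"
  assumes "a > 0" "t > 0" "continuous_on {0..t} f"
  shows "set_integrable lborel {0<..<t} (\<lambda>s. (t - s) powr (a - 1) * f s)"
proof -
  obtain C where C: "\<And>s. s \<in> {0..t} \<Longrightarrow> \<bar>f s\<bar> \<le> C"
    using compact_imp_bounded[OF compact_continuous_image[OF assms(3)]]
    by (force simp: bounded_iff)
  have "set_integrable lborel {0<..<t} (\<lambda>u. (t - u) powr (a - 1) * (u - 0) powr (1 - 1))"
    using assms by (intro set_integrable_beta_kernel) auto
  then have "set_integrable lborel {0<..<t} (\<lambda>u. C * ((t - u) powr (a - 1) * (u - 0) powr (1 - 1)))"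
    by (rule set_integrable_mult_right)
  then show ?thesis
  proof (rule set_integrable_bound)
    have "continuous_on {0<..<t} (\<lambda>s. (t - s) powr (a - 1) * f s)"
      using assms(3) by (intro continuous_intros) (auto intro: continuous_on_subset)
    then have "(\<lambda>s. indicator {0<..<t} s *\<^sub>R ((t - s) powr (a - 1) * f s)) \<in> borel_measurable borel"
      by (intro borel_measurable_continuous_on_indicator) auto
    then show "set_borel_measurable lborel {0<..<t} (\<lambda>s. (t - s) powr (a - 1) * f s)"
      by (simp add: set_borel_measurable_def)
  next
    show "AE x in lborel. x \<in> {0<..<t} \<longrightarrow> norm ((t - x) powr (a - 1) * f x)
       \<le> norm (C * ((t - x) powr (a - 1) * (x - 0) powr (1 - 1)))"
    proof (intro always_eventually allI impI)
      fix x assume x: "x \<in> {0<..<t}"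
      then have "\<bar>f x\<bar> \<le> \<bar>C\<bar>" using C[of x] by fastforce
      then show "norm ((t - x) powr (a - 1) * f x)
       \<le> norm (C * ((t - x) powr (a - 1) * (x - 0) powr (1 - 1)))"
        using x by (simp add: abs_mult mult.commute mult_right_mono)
    qed
  qed
qed

text \<open>A non-integrable function has integral 0 by convention, so linearity and comparison of
  \<open>frac_int\<close> have to carry integrability along.\<close>

definition frac_integrable :: "real \<Rightarrow> (real \<Rightarrow> real) \<Rightarrow> real \<Rightarrow> bool" where
  "frac_integrable a f t \<longleftrightarrow> set_integrable lborel {0<..<t} (\<lambda>s. (t - s) powr (a - 1) * f s)"

lemma frac_integrable_sum:
  assumes "\<And>i. i \<in> I \<Longrightarrow> frac_integrable a (f i) t"
  shows "frac_integrable a (\<lambda>s. \<Sum>i\<in>I. c i * f i s) t"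
    and "frac_int a (\<lambda>s. \<Sum>i\<in>I. c i * f i s) t = (\<Sum>i\<in>I. c i * frac_int a (f i) t)"
proof -
  have eq: "indicator {0<..<t} s *\<^sub>R ((t - s) powr (a - 1) * (\<Sum>i\<in>I. c i * f i s)) =
      (\<Sum>i\<in>I. c i * (indicator {0<..<t} s *\<^sub>R ((t - s) powr (a - 1) * f i s)))" for s
    by (simp add: sum_distrib_left mult_ac)
  have int: "integrable lborel (\<lambda>s. indicator {0<..<t} s *\<^sub>R ((t - s) powr (a - 1) * f i s))" if "i \<in> I" for i
    using assms[OF that] by (simp add: frac_integrable_def set_integrable_def)
  show "frac_integrable a (\<lambda>s. \<Sum>i\<in>I. c i * f i s) t"
    unfolding frac_integrable_def set_integrable_def eq
    by (intro Bochner_Integration.integrable_sum integrable_mult_right int)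
  show "frac_int a (\<lambda>s. \<Sum>i\<in>I. c i * f i s) t = (\<Sum>i\<in>I. c i * frac_int a (f i) t)"
    unfolding frac_int_def set_lebesgue_integral_def eq
    using int by (simp add: sum_distrib_left mult.left_commute)
qed

lemma frac_integrable_cmult:
  assumes "frac_integrable a f t"
  shows "frac_integrable a (\<lambda>s. c * f s) t"
    and "frac_int a (\<lambda>s. c * f s) t = c * frac_int a f t"
  using frac_integrable_sum[where I = "{()}" and c = "\<lambda>_. c" and f = "\<lambda>_. f"] assms by simp_all

text \<open>The kernel is non-negative, so a pointwise bound on the integrands passes to the
  fractional integrals. This propagates the error through one Picard step.\<close>

lemma frac_int_diff_abs_le:
  assumes "a > 0" "frac_integrable a f t" "frac_integrable a g t" "frac_integrable a h t"
    and le: "\<And>s. 0 < s \<Longrightarrow> s < t \<Longrightarrow> \<bar>f s - g s\<bar> \<le> h s"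
  shows "\<bar>frac_int a f t - frac_int a g t\<bar> \<le> frac_int a h t"
proof -
  let ?k = "\<lambda>f s. (t - s) powr (a - 1) * f s"
  have int: "set_integrable lborel {0<..<t} (?k f)" "set_integrable lborel {0<..<t} (?k g)"
    "set_integrable lborel {0<..<t} (?k h)"
    using assms by (simp_all add: frac_integrable_def)
  have diff: "set_integrable lborel {0<..<t} (\<lambda>s. ?k f s - ?k g s)"
    using int by (intro set_integral_diff)
  have "\<bar>(LBINT s:{0<..<t}. ?k f s) - (LBINT s:{0<..<t}. ?k g s)\<bar> = \<bar>LBINT s:{0<..<t}. ?k f s - ?k g s\<bar>"
    using int by simp
  also have "\<dots> \<le> (LBINT s:{0<..<t}. \<bar>?k f s - ?k g s\<bar>)"
    using set_integral_norm_bound[OF diff] by simp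
  also have "\<dots> \<le> (LBINT s:{0<..<t}. ?k h s)"
  proof (rule set_integral_mono)
    show "set_integrable lborel {0<..<t} (\<lambda>s. \<bar>?k f s - ?k g s\<bar>)"
      using set_integrable_abs[OF diff] .
    show "\<bar>?k f s - ?k g s\<bar> \<le> ?k h s" if "s \<in> {0<..<t}" for s
      using that le[of s] by (simp add: abs_mult mult_left_mono flip: right_diff_distrib)
  qed (use int in simp)
  finally have "1 / Gamma a * \<bar>(LBINT s:{0<..<t}. ?k f s) - (LBINT s:{0<..<t}. ?k g s)\<bar>
      \<le> 1 / Gamma a * (LBINT s:{0<..<t}. ?k h s)"
    using assms Gamma_real_pos[of a] by (intro mult_left_mono) auto
  moreover have "\<bar>frac_int a f t - frac_int a g t\<bar> =
      1 / Gamma a * \<bar>(LBINT s:{0<..<t}. ?k f s) - (LBINT s:{0<..<t}. ?k g s)\<bar>"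
    using assms Gamma_real_pos[of a]
    by (simp add: frac_int_def abs_mult flip: right_diff_distrib diff_divide_distrib)
  ultimately show ?thesis by (simp add: frac_int_def)
qed

section \<open>Inverting the Caputo derivative\<close>

text \<open>
  Only the product of \<open>deriv f\<close> with the singular kernel is assumed integrable; as the kernel is
  bounded below on \<open>(0, t)\<close>, \<open>deriv f\<close> itself is integrable there.
\<close>

lemma caputo_differentiable_set_integrable_deriv:
  assumes "0 < \<alpha>" "\<alpha> < 1" "caputo_differentiable \<alpha> f" "t > 0"
  shows "set_integrable lborel {0<..<t} (deriv f)"
proof -
  have int: "set_integrable lborel {0<..<t} (\<lambda>s. (t - s) powr (- \<alpha>) * deriv f s)"
    using assms by (simp add: caputo_differentiable_def)
  then have "set_integrable lborel {0<..<t} (\<lambda>s. t powr \<alpha> * ((t - s) powr (- \<alpha>) * deriv f s))"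
    by (rule set_integrable_mult_right)
  then show ?thesis
  proof (rule set_integrable_bound)
    \<comment> \<open>Multiplying the integrable product by the reciprocal of the kernel recovers
      measurability of \<open>deriv f\<close> on the interval.\<close>
    have "(\<lambda>s. (t - s) powr \<alpha> * (indicator {0<..<t} s *\<^sub>R ((t - s) powr (- \<alpha>) * deriv f s)))
      \<in> borel_measurable lborel"
      using int unfolding set_integrable_def
      by (intro borel_measurable_times) (auto dest: borel_measurable_integrable)
    also have "(\<lambda>s. (t - s) powr \<alpha> * (indicator {0<..<t} s *\<^sub>R ((t - s) powr (- \<alpha>) * deriv f s)))
      = (\<lambda>s. indicator {0<..<t} s *\<^sub>R deriv f s)"
      by (auto simp: fun_eq_iff indicator_def powr_minus field_simps)
    finally show "set_borel_measurable lborel {0<..<t} (deriv f)"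
      by (simp add: set_borel_measurable_def)
  next
    show "AE x in lborel. x \<in> {0<..<t} \<longrightarrow>
      norm (deriv f x) \<le> norm (t powr \<alpha> * ((t - x) powr - \<alpha> * deriv f x))"
    proof (intro always_eventually allI impI)
      fix x assume x: "x \<in> {0<..<t}"
      have "1 = t powr \<alpha> * t powr - \<alpha>"
        using assms by (simp add: powr_minus)
      also have "\<dots> \<le> t powr \<alpha> * (t - x) powr - \<alpha>"
        using x assms by (intro mult_left_mono powr_mono2') auto
      finally have "1 * \<bar>deriv f x\<bar> \<le> (t powr \<alpha> * (t - x) powr - \<alpha>) * \<bar>deriv f x\<bar>"
        by (intro mult_right_mono) auto
      then show "norm (deriv f x) \<le> norm (t powr \<alpha> * ((t - x) powr - \<alpha> * deriv f x))"
        by (simp add: abs_mult mult.assoc)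
    qed
  qed
qed

text \<open>For the gauge integral, continuity at the end points and differentiability inside
  suffice; integrability of \<open>deriv f\<close> is part of the conclusion, also for \<alpha> =
  1.\<close>

lemma caputo_differentiable_has_integral_deriv:
  assumes "caputo_differentiable \<alpha> f" "t > 0"
  shows "(deriv f has_integral (f t - f 0)) {0..t}"
proof (rule fundamental_theorem_of_calculus_interior)
  show "continuous_on {0..t} f"
    using assms by (auto simp: caputo_differentiable_def intro: continuous_on_subset)
  show "(f has_vector_derivative deriv f x) (at x)" if "x \<in> {0<..<t}" for x
    using that assms
    by (auto simp: caputo_differentiable_def real_differentiable_def DERIV_deriv_iff_real_differentiable
        intro!: has_real_derivative_iff_has_vector_derivative[THEN iffD1])
qed (use assms in auto)

text \<open>Fubini on the triangle 0 < s < u < t: integrating first over u leaves a constant times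
  \<open>deriv f s\<close>, and integrating first over s produces the Caputo derivative at
  u.\<close>

lemma frac_int_caputo_deriv_less_1:
  assumes "0 < \<alpha>" "\<alpha> < 1" "caputo_differentiable \<alpha> f" "t > 0"
  shows "frac_int \<alpha> (caputo_deriv \<alpha> f) t = f t - f 0"
proof -
  \<comment> \<open>\<open>deriv f\<close> is only known to be measurable on the interval, so it is
    cut off before entering the two-variable function. The indicators in \<open>h\<close> describe
    the triangle.\<close>
  define d where "d = (\<lambda>s. indicator {0<..<t} s * deriv f s)"
  define h where "h = (\<lambda>s u. indicator {0<..<t} s * (indicator {0<..<t} u * (indicator {s<..} u *
      ((t - u) powr (\<alpha> - 1) * ((u - s) powr (- \<alpha>) * d s)))))"
  have int: "integrable lborel d"
    using caputo_differentiable_set_integrable_deriv[OF assms] by (simp add: d_def set_integrable_def)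
  then have [measurable]: "d \<in> borel_measurable borel"
    using borel_measurable_integrable by force
  have [measurable]: "Measurable.pred (borel \<Otimes>\<^sub>M borel) (\<lambda>x::real \<times> real. snd x \<in> {fst x<..})"
    by simp
  have meas: "case_prod h \<in> borel_measurable (lborel \<Otimes>\<^sub>M lborel)"
    unfolding h_def indicator_def by measurable
  \<comment> \<open>The exponents \<alpha> and 1 - \<alpha> add up to 1, so the power of t - s
    disappears and the value does not depend on s.\<close>
  have inner: "has_bochner_integral lborel
      (\<lambda>u. indicator {s<..<t} u * ((t - u) powr (\<alpha> - 1) * (u - s) powr (- \<alpha>)))
      (Gamma \<alpha> * Gamma (1 - \<alpha>))" if "s \<in> {0<..<t}" for s
    using has_bochner_integral_beta_kernel[of \<alpha> "1 - \<alpha>" s t] that assms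
    by (simp add: Beta_def)
  have h_eq: "h s = (\<lambda>u. d s * (indicator {s<..<t} u * ((t - u) powr (\<alpha> - 1) * (u - s) powr (- \<alpha>))))"
    for s
    by (auto simp: fun_eq_iff h_def d_def indicator_def)
  have h_int: "integrable lborel (h s)" for s
    using inner[of s] by (cases "s \<in> {0<..<t}") (auto simp: h_eq d_def has_bochner_integral_iff)
  have h_val: "integral\<^sup>L lborel (h s) = d s * (Gamma \<alpha> * Gamma (1 - \<alpha>))" for s
    using inner[of s] by (cases "s \<in> {0<..<t}") (auto simp: h_eq d_def has_bochner_integral_iff)
  have h_norm: "(LINT u|lborel. norm (h s u)) = norm (d s) * (Gamma \<alpha> * Gamma (1 - \<alpha>))" for s
  proof -
    have "norm (h s u) = norm (d s) * (indicator {s<..<t} u * ((t - u) powr (\<alpha> - 1) * (u - s) powr (- \<alpha>)))" for u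
      by (simp add: h_eq abs_mult)
    then show ?thesis
      using inner[of s] by (cases "s \<in> {0<..<t}") (auto simp: d_def has_bochner_integral_iff)
  qed
  have pair: "integrable (lborel \<Otimes>\<^sub>M lborel) (case_prod h)"
  proof (rule lborel_pair.Fubini_integrable[OF meas])
    show "integrable lborel (\<lambda>x. LINT y|lborel. norm (case_prod h (x, y)))"
      using integrable_norm[OF int] by (simp only: prod.case h_norm) (rule integrable_mult_left)
  qed (use h_int in simp)
  have "(LINT s:{0<..<t}|lborel. deriv f s) = f t - f 0"
  proof -
    have "set_integrable lborel {0<..<t} (deriv f)"
      using caputo_differentiable_set_integrable_deriv[OF assms] .
    then have "(LINT s:{0<..<t}|lborel. deriv f s) = integral {0<..<t} (deriv f)"
      by (rule set_borel_integral_eq_integral)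
    also have "\<dots> = integral {0..t} (deriv f)"
      using integral_open_interval_real[of 0 t "deriv f"] by simp
    finally show ?thesis
      using caputo_differentiable_has_integral_deriv[OF assms(3,4)] by (simp add: integral_unique)
  qed
  then have "Gamma \<alpha> * Gamma (1 - \<alpha>) * (f t - f 0) = (LINT s|lborel. LINT u|lborel. h s u)"
    by (simp add: h_val d_def set_lebesgue_integral_def mult.commute)
  also have "\<dots> = (LINT u|lborel. LINT s|lborel. h s u)"
    using lborel_pair.Fubini_integral[OF pair] by simp
  also have "\<dots> = (LINT u:{0<..<t}|lborel. (t - u) powr (\<alpha> - 1) * (Gamma (1 - \<alpha>) * caputo_deriv \<alpha> f u))"
    unfolding set_lebesgue_integral_def
  proof (rule Bochner_Integration.integral_cong[OF refl])
    fix u :: real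
    show "(LINT s|lborel. h s u) =
      indicator {0<..<t} u *\<^sub>R ((t - u) powr (\<alpha> - 1) * (Gamma (1 - \<alpha>) * caputo_deriv \<alpha> f u))"
    proof (cases "u \<in> {0<..<t}")
      case True
      have "(LINT s|lborel. h s u) = (LINT s|lborel. (t - u) powr (\<alpha> - 1) *
          (indicator {0<..<u} s *\<^sub>R ((u - s) powr (- \<alpha>) * deriv f s)))"
        using True by (intro Bochner_Integration.integral_cong) (auto simp: h_def d_def indicator_def)
      also have "\<dots> = (t - u) powr (\<alpha> - 1) * (LBINT s:{0<..<u}. (u - s) powr (- \<alpha>) * deriv f s)"
        by (simp add: set_lebesgue_integral_def)
      also have "(LBINT s:{0<..<u}. (u - s) powr (- \<alpha>) * deriv f s) = Gamma (1 - \<alpha>) * caputo_deriv \<alpha> f u"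
        using assms less_imp_neq[OF Gamma_real_pos[of "1 - \<alpha>"]] by (simp add: caputo_deriv_def)
      finally show ?thesis using True by simp
    qed (simp add: h_def)
  qed
  also have "\<dots> = (LINT u:{0<..<t}|lborel. Gamma (1 - \<alpha>) * ((t - u) powr (\<alpha> - 1) * caputo_deriv \<alpha> f u))"
    by (simp add: mult_ac)
  also have "\<dots> = Gamma (1 - \<alpha>) * (Gamma \<alpha> * frac_int \<alpha> (caputo_deriv \<alpha> f) t)"
    using assms less_imp_neq[OF Gamma_real_pos[of \<alpha>]] by (simp add: frac_int_def)
  finally show ?thesis
    using assms less_imp_neq[OF Gamma_real_pos[of \<alpha>]] less_imp_neq[OF Gamma_real_pos[of "1 - \<alpha>"]]
    by simp
qed

text \<open>
  For \<open>\<alpha> = 1\<close> integrability of the derivative is not part of \<open>caputo_differentiable\<close>, so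
  it has to come from continuity of the right-hand side \<open>g\<close>.
\<close>

lemma caputo_imp_integral_equation:
  assumes "0 < \<alpha>" "\<alpha> \<le> 1" "caputo_differentiable \<alpha> f" "t > 0"
    and cont: "continuous_on {0..t} g"
    and eq: "\<And>s. 0 < s \<Longrightarrow> s < t \<Longrightarrow> caputo_deriv \<alpha> f s = g s"
  shows "f t - f 0 = frac_int \<alpha> g t"
proof -
  have cong: "frac_int \<alpha> (caputo_deriv \<alpha> f) t = frac_int \<alpha> g t"
    unfolding frac_int_def by (intro arg_cong2[where f = times] refl set_lebesgue_integral_cong) (auto simp: eq)
  show ?thesis
  proof (cases "\<alpha> < 1")
    case True
    then show ?thesis using frac_int_caputo_deriv_less_1[of \<alpha> f t] assms cong by simp
  next
    case False
    then have [simp]: "\<alpha> = 1" using assms by simp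
    have "set_integrable lborel {0<..<t} (\<lambda>s. (t - s) powr (1 - 1) * g s)"
      by (rule set_integrable_frac_kernel) (use assms in auto)
    then have int: "set_integrable lborel {0<..<t} g"
      by (rule set_integrable_cong[THEN iffD1, rotated -1]) auto
    have "frac_int 1 g t = (LBINT s:{0<..<t}. g s)"
      unfolding frac_int_def by (simp, intro set_lebesgue_integral_cong) auto
    \<comment> \<open>From here on the gauge integral is used, for which the fundamental theorem for
      \<open>deriv f\<close> is available.\<close>
    also have "\<dots> = integral {0<..<t} g"
      using int by (rule set_borel_integral_eq_integral)
    also have "\<dots> = integral {0<..<t} (deriv f)"
      using eq by (intro integral_cong) (auto simp: caputo_deriv_def)
    also have "\<dots> = integral {0..t} (deriv f)"
      using integral_open_interval_real[of 0 t "deriv f"] by simp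
    also have "\<dots> = f t - f 0"
      using caputo_differentiable_has_integral_deriv[OF assms(3,4)] by (rule integral_unique)
    finally show ?thesis by simp
  qed
qed

section \<open>Moments of convolution powers\<close>

text \<open>Formally this is f evaluated at exp x and expanded in powers of x, which explains why it
  respects products. The coefficient at 0 is the sum of all coefficients of f, as
  \<open>0 ^ 0 = 1\<close>.\<close>

definition moment_fps :: "real fps \<Rightarrow> real fps" where
  "moment_fps f = Abs_fps (\<lambda>r. (\<Sum>n. real n ^ r * fps_nth f n) / fact r)"

text \<open>The weighted l1 norm is submultiplicative: apply the triangle inequality to the Cauchy
  product and split w^n as w^i w^(n - i).\<close>

lemma abs_summable_fps_mult:
  fixes f g :: "real fps" and w :: real
  assumes w: "w \<ge> 0"
    and f: "summable (\<lambda>n. \<bar>fps_nth f n\<bar> * w ^ n)"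
    and g: "summable (\<lambda>n. \<bar>fps_nth g n\<bar> * w ^ n)"
  shows "summable (\<lambda>n. \<bar>fps_nth (f * g) n\<bar> * w ^ n)"
    and "(\<Sum>n. \<bar>fps_nth (f * g) n\<bar> * w ^ n) \<le>
      (\<Sum>n. \<bar>fps_nth f n\<bar> * w ^ n) * (\<Sum>n. \<bar>fps_nth g n\<bar> * w ^ n)"
proof -
  have sums: "(\<lambda>n. \<Sum>i\<le>n. (\<bar>fps_nth f i\<bar> * w ^ i) * (\<bar>fps_nth g (n - i)\<bar> * w ^ (n - i))) sums
      ((\<Sum>n. \<bar>fps_nth f n\<bar> * w ^ n) * (\<Sum>n. \<bar>fps_nth g n\<bar> * w ^ n))"
    using w f g by (intro Cauchy_product_sums) (auto simp: abs_mult)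
  have le: "\<bar>fps_nth (f * g) n\<bar> * w ^ n \<le>
      (\<Sum>i\<le>n. (\<bar>fps_nth f i\<bar> * w ^ i) * (\<bar>fps_nth g (n - i)\<bar> * w ^ (n - i)))" for n
  proof -
    have "\<bar>fps_nth (f * g) n\<bar> \<le> (\<Sum>i\<le>n. \<bar>fps_nth f i\<bar> * \<bar>fps_nth g (n - i)\<bar>)"
      unfolding fps_mult_nth atLeast0AtMost
      by (rule order_trans[OF sum_abs]) (simp add: abs_mult)
    then have "\<bar>fps_nth (f * g) n\<bar> * w ^ n \<le> (\<Sum>i\<le>n. \<bar>fps_nth f i\<bar> * \<bar>fps_nth g (n - i)\<bar>) * w ^ n"
      using w by (intro mult_right_mono) auto
    also have "\<dots> = (\<Sum>i\<le>n. (\<bar>fps_nth f i\<bar> * w ^ i) * (\<bar>fps_nth g (n - i)\<bar> * w ^ (n - i)))"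
    proof (unfold sum_distrib_right, intro sum.cong refl)
      fix i assume "i \<in> {..n}"
      then have "w ^ n = w ^ i * w ^ (n - i)" by (simp flip: power_add)
      then show "\<bar>fps_nth f i\<bar> * \<bar>fps_nth g (n - i)\<bar> * w ^ n =
        (\<bar>fps_nth f i\<bar> * w ^ i) * (\<bar>fps_nth g (n - i)\<bar> * w ^ (n - i))" by simp
    qed
    finally show ?thesis .
  qed
  show summable: "summable (\<lambda>n. \<bar>fps_nth (f * g) n\<bar> * w ^ n)"
    by (rule summable_comparison_test'[OF sums_summable[OF sums], of 0]) (use le w in \<open>simp add: abs_mult\<close>)
  show "(\<Sum>n. \<bar>fps_nth (f * g) n\<bar> * w ^ n) \<le>
      (\<Sum>n. \<bar>fps_nth f n\<bar> * w ^ n) * (\<Sum>n. \<bar>fps_nth g n\<bar> * w ^ n)"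
    using suminf_le[OF le summable sums_summable[OF sums]] sums_unique[OF sums] by simp
qed

text \<open>The norm of a k-th power grows at most geometrically in k, which the Gamma function in
  the denominators will outweigh.\<close>

lemma abs_summable_fps_power:
  fixes f :: "real fps" and w :: real
  assumes w: "w \<ge> 0" and f: "summable (\<lambda>n. \<bar>fps_nth f n\<bar> * w ^ n)"
  shows "summable (\<lambda>n. \<bar>fps_nth (f ^ k) n\<bar> * w ^ n) \<and>
    (\<Sum>n. \<bar>fps_nth (f ^ k) n\<bar> * w ^ n) \<le> (\<Sum>n. \<bar>fps_nth f n\<bar> * w ^ n) ^ k"
proof (induction k)
  case 0
  have "(\<lambda>n. \<bar>fps_nth (f ^ 0) n\<bar> * w ^ n) sums (\<Sum>n\<in>{0}. \<bar>fps_nth (f ^ 0) n\<bar> * w ^ n)"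
    by (rule sums_finite) auto
  then show ?case by (auto simp: sums_iff)
next
  case (Suc k)
  have "0 \<le> (\<Sum>n. \<bar>fps_nth f n\<bar> * w ^ n)"
    using f w by (intro suminf_nonneg) auto
  then have "(\<Sum>n. \<bar>fps_nth f n\<bar> * w ^ n) * (\<Sum>n. \<bar>fps_nth (f ^ k) n\<bar> * w ^ n) \<le>
      (\<Sum>n. \<bar>fps_nth f n\<bar> * w ^ n) * (\<Sum>n. \<bar>fps_nth f n\<bar> * w ^ n) ^ k"
    using Suc by (intro mult_left_mono) auto
  then show ?case
    using abs_summable_fps_mult[OF w f, of "f ^ k"] Suc by auto
qed

lemma power_over_fact_le_exp:
  fixes x :: real
  assumes "x \<ge> 0"
  shows "x ^ r / fact r \<le> exp x"
proof -
  have "(\<Sum>n\<in>{r}. x ^ n /\<^sub>R fact n) \<le> (\<Sum>n. x ^ n /\<^sub>R fact n)"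
    using assms by (intro sum_le_suminf summable_exp_generic) auto
  then show ?thesis by (simp add: exp_def divide_inverse mult.commute)
qed

text \<open>The constant comes from x^r / r! \<le> exp x at x = n ln w. It lets a geometric weight
  absorb the powers of n in the moments.\<close>

lemma power_le_geometric:
  fixes w :: real
  assumes "w > 1"
  obtains C where "C > 0" "\<And>n. real n ^ r \<le> C * w ^ n"
proof
  show "fact r / ln w ^ r > 0" using assms by simp
  show "real n ^ r \<le> fact r / ln w ^ r * w ^ n" for n
  proof -
    have "(real n * ln w) ^ r / fact r \<le> exp (real n * ln w)"
      using assms by (intro power_over_fact_le_exp) auto
    also have "\<dots> = w ^ n"
      using assms by (simp add: exp_of_nat_mult)
    finally show ?thesis
      using assms by (simp add: field_simps power_mult_distrib)
  qed
qed

lemma summable_moment: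
  fixes f :: "real fps" and w :: real
  assumes "w > 1" "summable (\<lambda>n. \<bar>fps_nth f n\<bar> * w ^ n)"
  shows "summable (\<lambda>n. norm (real n ^ r * fps_nth f n))"
proof -
  obtain C where C: "C > 0" "\<And>n. real n ^ r \<le> C * w ^ n"
    using power_le_geometric[OF assms(1), of r] by metis
  show ?thesis
  proof (rule summable_comparison_test'[OF summable_mult[OF assms(2), of C], of 0])
    fix n :: nat
    have "real n ^ r * \<bar>fps_nth f n\<bar> \<le> (C * w ^ n) * \<bar>fps_nth f n\<bar>"
      by (intro mult_right_mono C) auto
    then show "norm (norm (real n ^ r * fps_nth f n)) \<le> C * (\<bar>fps_nth f n\<bar> * w ^ n)"
      by (simp add: abs_mult mult_ac)
  qed
qed

text \<open>Up to the factor \<open>r!\<close> this is the binomial theorem for \<open>(i + (n - i))\<^sup>r\<close>.\<close>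

lemma moment_fps_mult:
  fixes f g :: "real fps"
  assumes f: "\<And>r. summable (\<lambda>n. norm (real n ^ r * fps_nth f n))"
    and g: "\<And>r. summable (\<lambda>n. norm (real n ^ r * fps_nth g n))"
  shows "moment_fps (f * g) = moment_fps f * moment_fps g"
proof (rule fps_ext)
  fix r
  have binom: "real n ^ r / fact r = (\<Sum>q=0..r. (real i ^ q / fact q) * (real (n - i) ^ (r - q) / fact (r - q)))"
    if "i \<le> n" for n i
  proof -
    have "real n ^ r = (real i + real (n - i)) ^ r"
      using that by (simp add: of_nat_diff)
    also have "\<dots> = (\<Sum>q\<le>r. real (r choose q) * real i ^ q * real (n - i) ^ (r - q))"
      by (rule binomial_ring)
    finally show ?thesis
      by (simp add: sum_divide_distrib atLeast0AtMost binomial_fact)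
  qed
  have "(\<lambda>n. \<Sum>i\<le>n. (real i ^ q * fps_nth f i) * (real (n - i) ^ (r - q) * fps_nth g (n - i))) sums
      ((\<Sum>n. real n ^ q * fps_nth f n) * (\<Sum>n. real n ^ (r - q) * fps_nth g n))" for q
    by (intro Cauchy_product_sums f g)
  then have "(\<lambda>n. \<Sum>q=0..r. (\<Sum>i\<le>n. (real i ^ q * fps_nth f i) * (real (n - i) ^ (r - q) * fps_nth g (n - i)))
        / (fact q * fact (r - q))) sums
      (\<Sum>q=0..r. (\<Sum>n. real n ^ q * fps_nth f n) * (\<Sum>n. real n ^ (r - q) * fps_nth g n) / (fact q * fact (r - q)))"
    by (intro sums_sum sums_divide)
  also have "(\<Sum>q=0..r. (\<Sum>n. real n ^ q * fps_nth f n) * (\<Sum>n. real n ^ (r - q) * fps_nth g n) / (fact q * fact (r - q)))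
     = fps_nth (moment_fps f * moment_fps g) r"
    by (simp add: fps_mult_nth moment_fps_def)
  also have "(\<lambda>n. \<Sum>q=0..r. (\<Sum>i\<le>n. (real i ^ q * fps_nth f i) * (real (n - i) ^ (r - q) * fps_nth g (n - i)))
        / (fact q * fact (r - q))) = (\<lambda>n. real n ^ r * fps_nth (f * g) n / fact r)"
  proof
    fix n
    have "real n ^ r * fps_nth (f * g) n / fact r = (\<Sum>i\<le>n. real n ^ r / fact r * (fps_nth f i * fps_nth g (n - i)))"
      by (simp add: fps_mult_nth atLeast0AtMost sum_distrib_left sum_divide_distrib)
    also have "\<dots> = (\<Sum>i\<le>n. \<Sum>q=0..r. (real i ^ q * fps_nth f i) * (real (n - i) ^ (r - q) * fps_nth g (n - i))
        / (fact q * fact (r - q)))"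
      by (intro sum.cong refl) (simp add: binom sum_distrib_left sum_distrib_right mult_ac)
    also have "\<dots> = (\<Sum>q=0..r. \<Sum>i\<le>n. (real i ^ q * fps_nth f i) * (real (n - i) ^ (r - q) * fps_nth g (n - i))
        / (fact q * fact (r - q)))"
      by (rule sum.swap)
    finally show "(\<Sum>q=0..r. (\<Sum>i\<le>n. (real i ^ q * fps_nth f i) * (real (n - i) ^ (r - q) * fps_nth g (n - i)))
        / (fact q * fact (r - q))) = real n ^ r * fps_nth (f * g) n / fact r"
      by (simp add: sum_divide_distrib)
  qed
  finally have sums: "(\<lambda>n. real n ^ r * fps_nth (f * g) n / fact r) sums fps_nth (moment_fps f * moment_fps g) r" .
  have "(\<lambda>n. real n ^ r * fps_nth (f * g) n) sums (fps_nth (moment_fps f * moment_fps g) r * fact r)"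
    using sums_mult2[OF sums, of "fact r"] by simp
  then show "fps_nth (moment_fps (f * g)) r = fps_nth (moment_fps f * moment_fps g) r"
    by (simp add: moment_fps_def sums_iff)
qed

lemma moment_fps_power:
  fixes f :: "real fps" and w :: real
  assumes "w > 1" "summable (\<lambda>n. \<bar>fps_nth f n\<bar> * w ^ n)"
  shows "moment_fps (f ^ k) = moment_fps f ^ k"
proof (induction k)
  case 0
  \<comment> \<open>Only n = 0 contributes, and \<open>0 ^ r\<close> is 1 exactly for r = 0, so the
    moment series of 1 is 1.\<close>
  have "(\<lambda>n. real n ^ r * fps_nth (1 :: real fps) n) sums (\<Sum>n\<in>{0}. real n ^ r * fps_nth (1 :: real fps) n)" for r
    by (rule sums_finite) auto
  then show ?case
    by (auto simp: fps_eq_iff moment_fps_def sums_iff power_0_left)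
next
  case (Suc k)
  have "summable (\<lambda>n. \<bar>fps_nth (f ^ k) n\<bar> * w ^ n)"
    using abs_summable_fps_power[of w f k] assms by simp
  then show ?case
    using moment_fps_mult[OF summable_moment summable_moment, OF assms assms(1)] Suc by simp
qed

section \<open>Coefficients of powers as sums over compositions\<close>

lemma finite_PiE_sum_eq:
  assumes "finite A"
  shows "finite {m \<in> A \<rightarrow>\<^sub>E (UNIV :: nat set). sum m A = r}"
proof (rule finite_subset)
  show "{m \<in> A \<rightarrow>\<^sub>E (UNIV :: nat set). sum m A = r} \<subseteq> A \<rightarrow>\<^sub>E {..r}"
    using assms by (auto intro!: PiE_I member_le_sum elim: PiE_arb)
  show "finite (A \<rightarrow>\<^sub>E {..r})"
    using assms by (intro finite_PiE) auto
qed

text \<open>Induction on k: a composition of r into k + 1 parts is its last part i together with a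
  composition of r - i into k parts. Extensionality makes this a bijection, since the value removed
  at \<open>Suc k\<close> is reset to \<open>undefined\<close>.\<close>

lemma fps_power_nth_PiE:
  fixes f :: "'a :: comm_ring_1 fps"
  shows "fps_nth (f ^ k) r =
    (\<Sum>m \<in> {m \<in> {1..k} \<rightarrow>\<^sub>E (UNIV :: nat set). (\<Sum>l=1..k. m l) = r}. \<Prod>l=1..k. fps_nth f (m l))"
proof (induction k arbitrary: r)
  case 0
  \<comment> \<open>The only extensional function on the empty set has sum 0: one composition for r
    = 0, none otherwise.\<close>
  then show ?case by (auto simp: if_distrib[of "\<lambda>S. sum _ S"] cong: conj_cong)
next
  case (Suc k)
  let ?S = "\<lambda>k r. {m \<in> {1..k} \<rightarrow>\<^sub>E (UNIV :: nat set). (\<Sum>l=1..k. m l) = r}"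
  have "fps_nth (f ^ Suc k) r = (\<Sum>i=0..r. \<Sum>m\<in>?S k (r - i). fps_nth f i * (\<Prod>l=1..k. fps_nth f (m l)))"
    by (simp add: fps_mult_nth Suc sum_distrib_left)
  also have "\<dots> = (\<Sum>(i, m)\<in>Sigma {0..r} (\<lambda>i. ?S k (r - i)). fps_nth f i * (\<Prod>l=1..k. fps_nth f (m l)))"
    by (intro sum.Sigma ballI finite_PiE_sum_eq) auto
  also have "\<dots> = (\<Sum>m\<in>?S (Suc k) r. \<Prod>l=1..Suc k. fps_nth f (m l))"
  proof (rule sum.reindex_bij_witness
      [where i = "\<lambda>m. (m (Suc k), m(Suc k := undefined))" and j = "\<lambda>(i, m). m(Suc k := i)"])
    fix p assume p: "p \<in> Sigma {0..r} (\<lambda>i. ?S k (r - i))"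
    then obtain i m where im: "p = (i, m)" "i \<le> r" "m \<in> {1..k} \<rightarrow>\<^sub>E UNIV" "(\<Sum>l=1..k. m l) = r - i" by auto
    have upd: "(\<Sum>l=1..k. (m(Suc k := i)) l) = (\<Sum>l=1..k. m l)"
      by (intro sum.cong) auto
    have updp: "(\<Prod>l=1..k. fps_nth f ((m(Suc k := i)) l)) = (\<Prod>l=1..k. fps_nth f (m l))"
      by (intro prod.cong) auto
    have "m (Suc k) = undefined"
      using PiE_arb[OF im(3), of "Suc k"] by simp
    then show "((case p of (i, m) \<Rightarrow> m(Suc k := i)) (Suc k), (case p of (i, m) \<Rightarrow> m(Suc k := i))(Suc k := undefined)) = p"
      using im by auto
    show "(case p of (i, m) \<Rightarrow> m(Suc k := i)) \<in> ?S (Suc k) r"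
      using im upd by (auto simp: PiE_def extensional_def)
    show "(\<Prod>l=1..Suc k. fps_nth f ((case p of (i, m) \<Rightarrow> m(Suc k := i)) l)) =
        (case p of (i, m) \<Rightarrow> fps_nth f i * (\<Prod>l=1..k. fps_nth f (m l)))"
      using im(1) updp by (simp add: mult.commute)
  next
    fix m assume m: "m \<in> ?S (Suc k) r"
    have upd: "(\<Sum>l=1..k. (m(Suc k := undefined)) l) = (\<Sum>l=1..k. m l)"
      by (intro sum.cong) auto
    show "(m (Suc k), m(Suc k := undefined)) \<in> Sigma {0..r} (\<lambda>i. ?S k (r - i))"
      using m upd by (auto simp: PiE_def extensional_def)
  qed auto
  finally show ?case .
qed

section \<open>Fractional convolution equations\<close>

text \<open>Restrict Euler's integral to t \<ge> c, where t powr x is at least c powr x. As c is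
  arbitrary, Gamma outgrows every geometric sequence.\<close>

lemma Gamma_plus1_ge:
  fixes c x :: real
  assumes "c > 0" "x \<ge> 0"
  shows "Gamma (x + 1) \<ge> c powr x * exp (- c)"
proof -
  have G: "((\<lambda>t. t powr x / exp t) has_integral Gamma (x + 1)) {0..}"
    using Gamma_integral_real[of "x + 1"] assms by simp
  have "((\<lambda>t. exp (- 1 * t)) has_integral exp (- 1 * c) / 1) {c..}"
    by (rule has_integral_exp_minus_to_infinity) simp
  then have "((\<lambda>t. c powr x * exp (- 1 * t)) has_integral c powr x * (exp (- 1 * c) / 1)) {c..}"
    by (rule has_integral_mult_right)
  then have "((\<lambda>t. if t \<in> {c..} then c powr x * exp (- t) else 0) has_integral c powr x * exp (- c)) {0..}"
    using assms by (subst has_integral_restrict) auto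
  then show ?thesis
  proof (rule has_integral_le[OF _ G])
    fix t :: real assume t: "t \<in> {0..}"
    show "(if t \<in> {c..} then c powr x * exp (- t) else 0) \<le> t powr x / exp t"
      using t assms by (auto simp: exp_minus field_simps intro!: powr_mono2)
  qed
qed

lemma summable_Mittag_Leffler:
  fixes \<alpha> x :: real
  assumes "\<alpha> > 0" "x \<ge> 0"
  shows "summable (\<lambda>k. x ^ k / Gamma (real k * \<alpha> + 1))"
proof -
  \<comment> \<open>Chosen so that c powr \<alpha> = 2x + 1; the terms are then dominated by a
    geometric series of ratio x / (2x + 1) < 1.\<close>
  define c where "c = (2 * x + 1) powr (1 / \<alpha>)"
  have c: "c > 0" using assms by (simp add: c_def)
  have c_pow: "c powr (real k * \<alpha>) = (2 * x + 1) ^ k" for k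
    using assms by (simp add: c_def powr_powr powr_realpow)
  have "summable (\<lambda>k. exp c * (x / (2 * x + 1)) ^ k)"
    using assms by (intro summable_mult summable_geometric) auto
  then show ?thesis
  proof (rule summable_comparison_test'[of _ 0])
    fix k :: nat
    have "Gamma (real k * \<alpha> + 1) \<ge> (2 * x + 1) ^ k * exp (- c)"
      using Gamma_plus1_ge[OF c, of "real k * \<alpha>"] assms c_pow by simp
    moreover have "(2 * x + 1) ^ k * exp (- c) > 0"
      using assms by simp
    moreover have "Gamma (real k * \<alpha> + 1) > 0"
      using calculation by linarith
    ultimately have "x ^ k / Gamma (real k * \<alpha> + 1) \<le> x ^ k / ((2 * x + 1) ^ k * exp (- c))"
      and "Gamma (real k * \<alpha> + 1) > 0"
      using assms by (auto intro!: divide_left_mono mult_pos_pos)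
    then show "norm (x ^ k / Gamma (real k * \<alpha> + 1)) \<le> exp c * (x / (2 * x + 1)) ^ k"
      using assms by (simp add: exp_minus field_simps power_divide)
  qed
qed

text \<open>For t > 0 this is the k-fold fractional integral of the constant 1; the normalisation
  makes \<open>frac_int\<close> raise k by one. Since \<open>0 powr y = 0\<close>, the value at t =
  0 is 0 even for k = 0.\<close>

definition frac_monomial :: "real \<Rightarrow> nat \<Rightarrow> real \<Rightarrow> real" where
  "frac_monomial \<alpha> k t = t powr (real k * \<alpha>) / Gamma (real k * \<alpha> + 1)"

lemma frac_monomial_0: "t > 0 \<Longrightarrow> frac_monomial \<alpha> 0 t = 1"
  by (simp add: frac_monomial_def)

lemma frac_monomial_nonneg:
  assumes "\<alpha> > 0" shows "frac_monomial \<alpha> k t \<ge> 0"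
proof -
  have "real k * \<alpha> + 1 > 0" using assms by (simp add: add_nonneg_pos)
  then show ?thesis using Gamma_real_pos by (simp add: frac_monomial_def less_imp_le)
qed

lemma frac_monomial_integral:
  assumes "\<alpha> > 0" "t > 0"
  shows "frac_integrable \<alpha> (frac_monomial \<alpha> k) t"
    and "frac_int \<alpha> (frac_monomial \<alpha> k) t = frac_monomial \<alpha> (Suc k) t"
proof -
  have k: "real k * \<alpha> + 1 > 0" using assms by (simp add: add_nonneg_pos)
  have "set_integrable lborel {0<..<t} (\<lambda>s. (t - s) powr (\<alpha> - 1) * (s - 0) powr ((real k * \<alpha> + 1) - 1))"
    by (rule set_integrable_beta_kernel) (use assms k in auto)
  then have "frac_integrable \<alpha> (\<lambda>s. s powr (real k * \<alpha>)) t"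
    by (simp add: frac_integrable_def)
  note * = frac_integrable_cmult[OF this]
  have mono: "frac_monomial \<alpha> k = (\<lambda>s. inverse (Gamma (real k * \<alpha> + 1)) * s powr (real k * \<alpha>))"
    by (simp add: fun_eq_iff frac_monomial_def field_simps)
  show "frac_integrable \<alpha> (frac_monomial \<alpha> k) t"
    using *(1) by (simp add: mono)
  have "frac_int \<alpha> (\<lambda>s. s powr (real k * \<alpha>)) t =
      Gamma (real k * \<alpha> + 1) / Gamma (\<alpha> + real k * \<alpha> + 1) * t powr (\<alpha> + real k * \<alpha>)"
    using assms k by (intro frac_int_powr) auto
  then show "frac_int \<alpha> (frac_monomial \<alpha> k) t = frac_monomial \<alpha> (Suc k) t"
    using *(2) Gamma_real_pos[OF k] by (simp add: mono, simp add: frac_monomial_def algebra_simps)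
qed

lemma summable_frac_monomial:
  assumes "\<alpha> > 0" "t > 0" "B \<ge> 0"
  shows "summable (\<lambda>k. B ^ k * frac_monomial \<alpha> k t)"
proof -
  have "B ^ k * frac_monomial \<alpha> k t = (B * t powr \<alpha>) ^ k / Gamma (real k * \<alpha> + 1)" for k
  proof -
    have "t powr (real k * \<alpha>) = (t powr \<alpha>) ^ k"
      using assms by (simp add: powr_powr mult.commute flip: powr_realpow)
    then show ?thesis by (simp add: frac_monomial_def power_mult_distrib)
  qed
  then show ?thesis
    using summable_Mittag_Leffler[of \<alpha> "B * t powr \<alpha>"] assms by simp
qed

text \<open>Picard iteration, started from the trivial bound \<open>\<bar>p n t\<bar> \<le> 1\<close>.\<close>

lemma convolution_equation_remainder:
  fixes f :: "real fps" and p :: "nat \<Rightarrow> real \<Rightarrow> real"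
  assumes "\<alpha> > 0"
    and cont: "\<And>n. continuous_on {0..} (p n)"
    and bounded: "\<And>n t. \<bar>p n t\<bar> \<le> 1"
    and eq: "\<And>n t. t > 0 \<Longrightarrow> p n t = (if n = 0 then 1 else 0) +
        frac_int \<alpha> (\<lambda>s. \<Sum>j=0..n. fps_nth f j * p (n - j) s) t"
    and B: "\<And>n. (\<Sum>j=0..n. \<bar>fps_nth f j\<bar>) \<le> B"
    and "t > 0"
  shows "\<bar>p n t - (\<Sum>k<K. fps_nth (f ^ k) n * frac_monomial \<alpha> k t)\<bar> \<le> B ^ K * frac_monomial \<alpha> K t"
  using \<open>t > 0\<close>
proof (induction K arbitrary: n t)
  case 0
  then show ?case using bounded by (simp add: frac_monomial_0)
next
  case (Suc K)
  let ?g = "\<lambda>s. \<Sum>j=0..n. fps_nth f j * p (n - j) s"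
  \<comment> \<open>Convolving f with the K-th partial sums raises the power of f but not yet the
    order of the monomial; integration then raises the order and yields the terms 1 to K of the next
    partial sum.\<close>
  let ?h = "\<lambda>s. \<Sum>k<K. fps_nth (f ^ Suc k) n * frac_monomial \<alpha> k s"
  have h: "frac_integrable \<alpha> ?h t"
    "frac_int \<alpha> ?h t = (\<Sum>k<K. fps_nth (f ^ Suc k) n * frac_int \<alpha> (frac_monomial \<alpha> k) t)"
    using frac_monomial_integral(1)[OF \<open>\<alpha> > 0\<close> Suc.prems] by (intro frac_integrable_sum; simp)+
  note Bint = frac_integrable_cmult[OF frac_monomial_integral(1)[OF \<open>\<alpha> > 0\<close> Suc.prems], of "B ^ Suc K" K]
  have g: "frac_integrable \<alpha> ?g t"
    unfolding frac_integrable_def using \<open>\<alpha> > 0\<close> Suc.prems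
    by (intro set_integrable_frac_kernel continuous_intros continuous_on_subset[OF cont]) auto
  \<comment> \<open>The difference is the convolution of f with the previous errors, so it gains a
    factor B.\<close>
  have "\<bar>?g s - ?h s\<bar> \<le> B ^ Suc K * frac_monomial \<alpha> K s" if "0 < s" for s
  proof -
    have "?h s = (\<Sum>k<K. \<Sum>j=0..n. fps_nth f j * (fps_nth (f ^ k) (n - j) * frac_monomial \<alpha> k s))"
      by (intro sum.cong) (simp_all add: fps_mult_nth sum_distrib_right mult.assoc)
    also have "\<dots> = (\<Sum>j=0..n. \<Sum>k<K. fps_nth f j * (fps_nth (f ^ k) (n - j) * frac_monomial \<alpha> k s))"
      by (rule sum.swap)
    finally have "?g s - ?h s = (\<Sum>j=0..n. fps_nth f j *
        (p (n - j) s - (\<Sum>k<K. fps_nth (f ^ k) (n - j) * frac_monomial \<alpha> k s)))"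
      by (simp add: right_diff_distrib sum_subtractf sum_distrib_left)
    also have "\<bar>\<dots>\<bar> \<le> (\<Sum>j=0..n. \<bar>fps_nth f j\<bar> * (B ^ K * frac_monomial \<alpha> K s))"
      using Suc.IH[OF that] by (intro order_trans[OF sum_abs] sum_mono) (simp add: abs_mult mult_left_mono)
    also have "\<dots> = (\<Sum>j=0..n. \<bar>fps_nth f j\<bar>) * (B ^ K * frac_monomial \<alpha> K s)"
      by (simp add: sum_distrib_right)
    also have "\<dots> \<le> B * (B ^ K * frac_monomial \<alpha> K s)"
    proof (intro mult_right_mono B mult_nonneg_nonneg frac_monomial_nonneg \<open>\<alpha> > 0\<close>)
      show "0 \<le> B ^ K" using B[of 0] by simp
    qed
    finally show ?thesis by (simp add: mult_ac)
  qed
  then have "\<bar>frac_int \<alpha> ?g t - frac_int \<alpha> ?h t\<bar> \<le> frac_int \<alpha> (\<lambda>s. B ^ Suc K * frac_monomial \<alpha> K s) t"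
    using Bint(1) by (intro frac_int_diff_abs_le \<open>\<alpha> > 0\<close> g h) auto
  also have "\<dots> = B ^ Suc K * frac_monomial \<alpha> (Suc K) t"
    using Bint(2) frac_monomial_integral(2)[OF \<open>\<alpha> > 0\<close> Suc.prems] by simp
  \<comment> \<open>The initial value of p supplies the term k = 0, because \<open>f ^ 0\<close> has
    coefficient 1 at 0 and 0 elsewhere.\<close>
  also have "frac_int \<alpha> ?g t - frac_int \<alpha> ?h t =
      p n t - (\<Sum>k<Suc K. fps_nth (f ^ k) n * frac_monomial \<alpha> k t)"
    using Suc.prems frac_monomial_integral(2)[OF \<open>\<alpha> > 0\<close> Suc.prems]
    by (subst eq[OF Suc.prems], simp only: h(2) sum.lessThan_Suc_shift) (simp add: frac_monomial_0)
  finally show ?case .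
qed

text \<open>Fubini for an absolutely summable array indexed by k and n: summing over n for fixed k
  gives the moments of \<open>f ^ k\<close>, summing over k for fixed n gives n^r times
  \<open>p n t\<close>.\<close>

lemma convolution_equation_moment_sums:
  fixes f :: "real fps" and p :: "nat \<Rightarrow> real \<Rightarrow> real"
  assumes "\<alpha> > 0"
    and cont: "\<And>n. continuous_on {0..} (p n)"
    and bounded: "\<And>n t. \<bar>p n t\<bar> \<le> 1"
    and eq: "\<And>n t. t > 0 \<Longrightarrow> p n t = (if n = 0 then 1 else 0) +
        frac_int \<alpha> (\<lambda>s. \<Sum>j=0..n. fps_nth f j * p (n - j) s) t"
    and w: "w > 1" "summable (\<lambda>n. \<bar>fps_nth f n\<bar> * w ^ n)"
    and zero: "(\<Sum>n. fps_nth f n) = 0"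
    and "t > 0"
  shows "(\<lambda>n. real n ^ r * p n t) sums
    (fact r * (\<Sum>k\<le>r. frac_monomial \<alpha> k t * fps_nth (moment_fps f ^ k) r))"
proof -
  define B where "B = (\<Sum>n. \<bar>fps_nth f n\<bar> * w ^ n)"
  have B0: "B \<ge> 0"
    unfolding B_def using w by (intro suminf_nonneg) auto
  have B: "(\<Sum>j=0..n. \<bar>fps_nth f j\<bar>) \<le> B" for n
  proof -
    have "(\<Sum>j=0..n. \<bar>fps_nth f j\<bar>) \<le> (\<Sum>j=0..n. \<bar>fps_nth f j\<bar> * w ^ j)"
    proof (intro sum_mono)
      fix j show "\<bar>fps_nth f j\<bar> \<le> \<bar>fps_nth f j\<bar> * w ^ j"
        using mult_left_mono[of 1 "w ^ j" "\<bar>fps_nth f j\<bar>"] w by simp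
    qed
    also have "\<dots> \<le> B"
      unfolding B_def using w by (intro sum_le_suminf) auto
    finally show ?thesis .
  qed
  have summable_B: "summable (\<lambda>k. B ^ k * frac_monomial \<alpha> k t)"
    using summable_frac_monomial[OF \<open>\<alpha> > 0\<close> \<open>t > 0\<close> B0] .
  have p_sums: "(\<lambda>k. fps_nth (f ^ k) n * frac_monomial \<alpha> k t) sums p n t" for n
  proof -
    have "(\<lambda>K. p n t - (\<Sum>k<K. fps_nth (f ^ k) n * frac_monomial \<alpha> k t)) \<longlonglongrightarrow> 0"
    proof (rule Lim_null_comparison[OF always_eventually summable_LIMSEQ_zero[OF summable_B]])
      show "\<forall>K. norm (p n t - (\<Sum>k<K. fps_nth (f ^ k) n * frac_monomial \<alpha> k t)) \<le> B ^ K * frac_monomial \<alpha> K t"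
        using convolution_equation_remainder[where p = p and f = f, OF \<open>\<alpha> > 0\<close> cont bounded eq B \<open>t > 0\<close>]
        by simp
    qed
    from tendsto_diff[OF tendsto_const[of "p n t"] this] show ?thesis
      by (simp add: sums_def)
  qed
  obtain C where C: "C > 0" "\<And>n. real n ^ r \<le> C * w ^ n"
    using power_le_geometric[OF w(1), of r] by metis
  define F where "F = (\<lambda>(k, n). frac_monomial \<alpha> k t * (real n ^ r * fps_nth (f ^ k) n))"
  have pow: "summable (\<lambda>n. \<bar>fps_nth (f ^ k) n\<bar> * w ^ n)" "(\<Sum>n. \<bar>fps_nth (f ^ k) n\<bar> * w ^ n) \<le> B ^ k" for k
    using abs_summable_fps_power[of w f k] w by (auto simp: B_def)
  have F_abs: "(\<lambda>n. norm (F (k, n))) sums (\<Sum>n. norm (F (k, n)))" for k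
    using summable_mult[OF summable_moment[OF w(1) pow(1)[of k], of r], of "\<bar>frac_monomial \<alpha> k t\<bar>"]
    by (simp add: F_def abs_mult summable_sums)
  have F_summable: "F summable_on UNIV \<times> UNIV"
  proof (rule abs_summable_summable, rule summable_on_SigmaI)
    show "((\<lambda>n. norm (F (k, n))) has_sum (\<Sum>n. norm (F (k, n)))) UNIV" for k
      using F_abs[of k] by (intro sums_nonneg_imp_has_sum) auto
    show "(\<lambda>k. \<Sum>n. norm (F (k, n))) summable_on UNIV"
    proof (subst summable_on_UNIV_nonneg_real_iff)
      show "0 \<le> (\<Sum>n. norm (F (k, n)))" for k
        using sums_summable[OF F_abs[of k]] by (intro suminf_nonneg) auto
      \<comment> \<open>Bounding n^r by C w^n leaves C B^k times the monomial, a convergent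
        Mittag-Leffler series.\<close>
      show "summable (\<lambda>k. \<Sum>n. norm (F (k, n)))"
      proof (rule summable_comparison_test'[OF summable_mult[OF summable_B, of C], of 0])
        fix k :: nat
        have le: "norm (F (k, n)) \<le> (frac_monomial \<alpha> k t * C) * (\<bar>fps_nth (f ^ k) n\<bar> * w ^ n)" for n
        proof -
          have "norm (F (k, n)) = frac_monomial \<alpha> k t * (real n ^ r * \<bar>fps_nth (f ^ k) n\<bar>)"
            using frac_monomial_nonneg[OF \<open>\<alpha> > 0\<close>] by (simp add: F_def abs_mult)
          also have "\<dots> \<le> frac_monomial \<alpha> k t * ((C * w ^ n) * \<bar>fps_nth (f ^ k) n\<bar>)"
            using frac_monomial_nonneg[OF \<open>\<alpha> > 0\<close>] C by (intro mult_left_mono mult_right_mono) auto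
          finally show ?thesis by (simp add: mult_ac)
        qed
        have "(\<Sum>n. norm (F (k, n))) \<le> (\<Sum>n. (frac_monomial \<alpha> k t * C) * (\<bar>fps_nth (f ^ k) n\<bar> * w ^ n))"
          using le sums_summable[OF F_abs[of k]] summable_mult[OF pow(1)] by (rule suminf_le)
        also have "\<dots> = (frac_monomial \<alpha> k t * C) * (\<Sum>n. \<bar>fps_nth (f ^ k) n\<bar> * w ^ n)"
          by (rule suminf_mult[OF pow(1)])
        also have "\<dots> \<le> (frac_monomial \<alpha> k t * C) * B ^ k"
          using frac_monomial_nonneg[OF \<open>\<alpha> > 0\<close>] C by (intro mult_left_mono pow mult_nonneg_nonneg) auto
        finally show "norm (\<Sum>n. norm (F (k, n))) \<le> C * (B ^ k * frac_monomial \<alpha> k t)"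
          using suminf_nonneg[OF sums_summable[OF F_abs[of k]]] by (simp add: mult_ac)
      qed
    qed
  qed auto
  define S where "S = infsum F (UNIV \<times> UNIV)"
  have S: "(F has_sum S) (UNIV \<times> UNIV)"
    using F_summable by (simp add: S_def)
  have row: "((\<lambda>n. F (k, n)) has_sum (frac_monomial \<alpha> k t * (fact r * fps_nth (moment_fps f ^ k) r))) UNIV" for k
  proof (rule norm_summable_imp_has_sum[OF sums_summable[OF F_abs]])
    have "(\<lambda>n. real n ^ r * fps_nth (f ^ k) n) sums (fact r * fps_nth (moment_fps (f ^ k)) r)"
      using summable_norm_cancel[OF summable_moment[OF w(1) pow(1)[of k], of r]]
      by (simp add: moment_fps_def summable_sums)
    then show "(\<lambda>n. F (k, n)) sums (frac_monomial \<alpha> k t * (fact r * fps_nth (moment_fps f ^ k) r))"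
      using moment_fps_power[OF w] by (simp add: F_def sums_mult)
  qed
  have "((\<lambda>k. frac_monomial \<alpha> k t * (fact r * fps_nth (moment_fps f ^ k) r)) has_sum S) UNIV"
    using has_sum_SigmaD[OF S row] .
  then have "(\<lambda>k. frac_monomial \<alpha> k t * (fact r * fps_nth (moment_fps f ^ k) r)) sums S"
    by (rule has_sum_imp_sums)
  moreover have "(\<lambda>k. frac_monomial \<alpha> k t * (fact r * fps_nth (moment_fps f ^ k) r)) sums
      (\<Sum>k\<le>r. frac_monomial \<alpha> k t * (fact r * fps_nth (moment_fps f ^ k) r))"
  proof (rule sums_finite)
    \<comment> \<open>Without a constant term, the k-th power of the moment series has no
      coefficient below k, which truncates the sum at r.\<close>
    have "fps_nth (moment_fps f) 0 = 0"
      using zero by (simp add: moment_fps_def)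
    then show "frac_monomial \<alpha> k t * (fact r * fps_nth (moment_fps f ^ k) r) = 0" if "k \<notin> {..r}" for k
      using that startsby_zero_power_prefix[of "moment_fps f" k] by simp
  qed simp
  ultimately have S_eq: "S = (\<Sum>k\<le>r. frac_monomial \<alpha> k t * (fact r * fps_nth (moment_fps f ^ k) r))"
    by (rule sums_unique2)
  have "((\<lambda>(n, k). F (k, n)) has_sum S) (UNIV \<times> UNIV)"
    using S by (subst (asm) has_sum_swap)
  moreover have "((\<lambda>k. (\<lambda>(n, k). F (k, n)) (n, k)) has_sum (real n ^ r * p n t)) UNIV" for n
  proof -
    have "(\<lambda>(n, k). F (k, n)) summable_on UNIV \<times> UNIV"
      using calculation by (rule has_sum_imp_summable)
    \<comment> \<open>Slicing the array gives existence of the unordered sum; its value is then read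
      off from the ordered series for p.\<close>
    then have "(\<lambda>k. F (k, n)) summable_on UNIV"
      using summable_on_SigmaD1[where f = "\<lambda>n k. F (k, n)" and A = UNIV and B = "\<lambda>_. UNIV" and x = n] by simp
    then obtain x where x: "((\<lambda>k. F (k, n)) has_sum x) UNIV"
      by (auto simp: summable_on_def)
    have "(\<lambda>k. F (k, n)) sums (real n ^ r * p n t)"
      using sums_mult[OF p_sums[of n], of "real n ^ r"] by (simp add: F_def mult_ac)
    then have "x = real n ^ r * p n t"
      using has_sum_imp_sums[OF x] by (rule sums_unique2[symmetric])
    then show ?thesis using x by simp
  qed
  ultimately have "((\<lambda>n. real n ^ r * p n t) has_sum S) UNIV"
    by (rule has_sum_SigmaD)
  then show ?thesis
    using has_sum_imp_sums S_eq by (simp add: sum_distrib_left mult_ac)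
qed

section \<open>The convoluted fractional Poisson process\<close>

text \<open>Either form of the limit condition gives, from some index on, decay by a factor q < 1
  per step; the ratio test then leaves room for a weight w > 1.\<close>

lemma intensity_summable_geometric:
  assumes "intensity_parameters lam"
  obtains w where "w > 1" "summable (\<lambda>j::nat. lam (int j) * w ^ j)"
proof -
  have nonneg: "lam (int j) \<ge> 0" for j :: nat
    using assms by (cases "j = 0") (auto simp: intensity_parameters_def less_imp_le)
  have mono: "lam (int (Suc j)) \<le> lam (int j)" for j :: nat
    using assms by (auto simp: intensity_parameters_def)
  have "\<exists>q n0. 0 < q \<and> q < 1 \<and> (\<forall>j\<ge>n0. lam (int (Suc j)) \<le> q * lam (int j))"
  proof (cases "\<forall>\<^sub>F j::nat in sequentially. lam (int j) = 0")
    case True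
    then obtain n0 where "\<And>j. j \<ge> n0 \<Longrightarrow> lam (int j) = 0"
      by (auto simp: eventually_sequentially)
    moreover from this have "\<And>j. j \<ge> n0 \<Longrightarrow> lam (int (Suc j)) = 0" by (metis le_SucI)
    ultimately show ?thesis by (intro exI[of _ "1/2"] exI[of _ n0]) auto
  next
    case False
    then obtain L where L: "L < 1" "(\<lambda>j::nat. lam (int j + 1) / lam (int j)) \<longlonglongrightarrow> L"
      using assms by (auto simp: intensity_parameters_def)
    \<comment> \<open>The midpoint of L and 1, kept at least 1/2 so that it is visibly
      positive.\<close>
    define q where "q = max (1/2) ((1 + L) / 2)"
    have q: "0 < q" "q < 1" "L < q" using L by (auto simp: q_def max_def)
    then have "\<forall>\<^sub>F j::nat in sequentially. lam (int j + 1) / lam (int j) < q"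
      using L order_tendstoD(2) by blast
    then obtain n0 where n0: "\<And>j. j \<ge> n0 \<Longrightarrow> lam (int j + 1) / lam (int j) < q"
      by (auto simp: eventually_sequentially)
    \<comment> \<open>Where \<open>lam\<close> vanishes the quotient is 0 by convention and carries
      no information; monotonicity gives the bound there.\<close>
    have "lam (int (Suc j)) \<le> q * lam (int j)" if "j \<ge> n0" for j
    proof (cases "lam (int j) = 0")
      case True
      then show ?thesis using mono[of j] by simp
    next
      case False
      then show ?thesis using n0[OF that] nonneg[of j] by (simp add: field_simps)
    qed
    then show ?thesis using q by blast
  qed
  then obtain q n0 where q: "0 < q" "q < 1" and step: "\<And>j. j \<ge> n0 \<Longrightarrow> lam (int (Suc j)) \<le> q * lam (int j)"
    by blast
  show thesis
  proof
    \<comment> \<open>This weight lies strictly between 1 and 1 / q.\<close>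
    show "2 / (1 + q) > 1" using q by simp
    show "summable (\<lambda>j::nat. lam (int j) * (2 / (1 + q)) ^ j)"
    proof (rule summable_ratio_test)
      show "q * (2 / (1 + q)) < 1" using q by (simp add: field_simps)
      fix j :: nat assume "j \<ge> n0"
      then have "lam (int (Suc j)) * (2 / (1 + q)) ^ Suc j \<le> q * lam (int j) * (2 / (1 + q)) ^ Suc j"
        using step q by (intro mult_right_mono) auto
      then show "norm (lam (int (Suc j)) * (2 / (1 + q)) ^ Suc j)
          \<le> q * (2 / (1 + q)) * norm (lam (int j) * (2 / (1 + q)) ^ j)"
        using q nonneg[of j] nonneg[of "Suc j"] by (simp add: abs_mult mult_ac)
    qed
  qed
qed

text \<open>For intensity parameters the entry at 0 is \<open>- lam 0\<close>, since
  \<open>lam\<close> vanishes at -1, and all later entries are non-negative by monotonicity.\<close>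

definition jump_rate :: "(int \<Rightarrow> real) \<Rightarrow> nat \<Rightarrow> real" where
  "jump_rate lam j = lam (int j - 1) - lam (int j)"

text \<open>Each entry after the first is at most the preceding intensity, so the weight for the
  intensities still works; the index shift costs one factor w.\<close>

lemma jump_rate_summable_geometric:
  assumes "intensity_parameters lam"
  obtains w where "w > 1" "summable (\<lambda>j. \<bar>jump_rate lam j\<bar> * w ^ j)"
proof -
  obtain w where w: "w > 1" and sum: "summable (\<lambda>j::nat. lam (int j) * w ^ j)"
    using intensity_summable_geometric[OF assms] .
  have nonneg: "lam (int j) \<ge> 0" for j :: nat
    using assms by (cases "j = 0") (auto simp: intensity_parameters_def less_imp_le)
  have "summable (\<lambda>j. \<bar>jump_rate lam (Suc j)\<bar> * w ^ Suc j)"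
  proof (rule summable_comparison_test'[OF summable_mult[OF sum, of w], of 0])
    fix j :: nat
    have "\<bar>jump_rate lam (Suc j)\<bar> \<le> lam (int j)"
      using assms nonneg[of j] nonneg[of "Suc j"] by (auto simp: jump_rate_def intensity_parameters_def)
    then have "\<bar>jump_rate lam (Suc j)\<bar> * w ^ Suc j \<le> lam (int j) * w ^ Suc j"
      using w by (intro mult_right_mono) auto
    then show "norm (\<bar>jump_rate lam (Suc j)\<bar> * w ^ Suc j) \<le> w * (lam (int j) * w ^ j)"
      using w by (simp add: abs_mult mult_ac)
  qed
  then show thesis using w that by (subst (asm) summable_Suc_iff)
qed

text \<open>The entries from index 1 on telescope to \<open>lam 0\<close>, as the intensities tend
  to 0, and cancel the entry at 0.\<close>

lemma suminf_jump_rate: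
  assumes "intensity_parameters lam"
  shows "(\<Sum>j. jump_rate lam j) = 0"
proof -
  obtain w where w: "w > 1" and sum: "summable (\<lambda>j::nat. lam (int j) * w ^ j)"
    using intensity_summable_geometric[OF assms] .
  have nonneg: "lam (int j) \<ge> 0" for j :: nat
    using assms by (cases "j = 0") (auto simp: intensity_parameters_def less_imp_le)
  have "lam (int j) \<le> lam (int j) * w ^ j" for j
    using w nonneg[of j] mult_left_mono[of 1 "w ^ j" "lam (int j)"] by simp
  then have "summable (\<lambda>j. lam (int j))"
    using nonneg by (intro summable_comparison_test'[OF sum, of 0]) auto
  then have "(\<lambda>j. lam (int j)) \<longlonglongrightarrow> 0"
    by (rule summable_LIMSEQ_zero)
  then have "(\<lambda>j. lam (int j) - lam (int (Suc j))) sums (lam (int 0) - 0)"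
    by (rule telescope_sums')
  then have "(\<lambda>j. jump_rate lam (Suc j)) sums lam 0"
    by (simp add: jump_rate_def)
  then have "jump_rate lam sums (lam 0 + jump_rate lam 0)"
    by (subst (asm) sums_Suc_iff) simp
  moreover have "jump_rate lam 0 = - lam 0"
    using assms by (simp add: jump_rate_def intensity_parameters_def)
  ultimately show ?thesis by (simp add: sums_iff)
qed

section \<open>Expectations from state probabilities\<close>

text \<open>Decompose over the level sets of X and integrate termwise in the extended non-negative
  reals. Integrability thus follows from convergence of the series.\<close>

lemma (in finite_measure) has_bochner_integral_nat_valued:
  fixes X :: "'a \<Rightarrow> nat" and g :: "nat \<Rightarrow> real"
  assumes X: "X \<in> measurable M (count_space UNIV)"
    and nonneg: "\<And>n. g n \<ge> 0"
    and sums: "(\<lambda>n. g n * measure M {\<omega> \<in> space M. X \<omega> = n}) sums S"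
  shows "has_bochner_integral M (\<lambda>\<omega>. g (X \<omega>)) S"
proof -
  note [measurable] = X
  have S: "S \<ge> 0"
    using sums_le[OF _ sums_zero sums] nonneg by auto
  have "(\<integral>\<^sup>+\<omega>. ennreal (g (X \<omega>)) \<partial>M) =
      (\<integral>\<^sup>+\<omega>. (\<Sum>n. ennreal (g n) * indicator {\<omega> \<in> space M. X \<omega> = n} \<omega>) \<partial>M)"
  proof (rule nn_integral_cong)
    fix \<omega> assume "\<omega> \<in> space M"
    then have "(\<lambda>n. ennreal (g n) * indicator {\<omega> \<in> space M. X \<omega> = n} \<omega>) sums
        (\<Sum>n\<in>{X \<omega>}. ennreal (g n) * indicator {\<omega> \<in> space M. X \<omega> = n} \<omega>)"
      by (intro sums_finite) auto
    then show "ennreal (g (X \<omega>)) = (\<Sum>n. ennreal (g n) * indicator {\<omega> \<in> space M. X \<omega> = n} \<omega>)"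
      using \<open>\<omega> \<in> space M\<close> by (simp add: sums_iff)
  qed
  also have "\<dots> = (\<Sum>n. \<integral>\<^sup>+\<omega>. ennreal (g n) * indicator {\<omega> \<in> space M. X \<omega> = n} \<omega> \<partial>M)"
    by (rule nn_integral_suminf) measurable
  also have "\<dots> = (\<Sum>n. ennreal (g n * measure M {\<omega> \<in> space M. X \<omega> = n}))"
    using nonneg by (intro suminf_cong) (simp add: nn_integral_cmult emeasure_eq_measure ennreal_mult)
  also have "\<dots> = ennreal S"
    using nonneg by (intro suminf_ennreal_eq[OF _ sums]) simp
  finally show ?thesis
    using S nonneg by (intro has_bochner_integral_nn_integral) auto
qed

section \<open>From the evolution equation to the moments\<close>

context convoluted_fractional_poisson
begin

text \<open>The convolutions over all integers become finite sums because \<open>lam\<close>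
  vanishes at negative indices and the probabilities vanish at negative states.\<close>

lemma state_equation_rhs:
  assumes "t \<ge> 0"
  shows "- discrete_conv lam (\<lambda>m. state_prob M N m t) (int n) +
      discrete_conv lam (\<lambda>m. state_prob M N m t) (int n - 1) =
      (\<Sum>j=0..n. jump_rate lam j * state_prob M N (int (n - j)) t)"
proof -
  have neg: "lam j = 0" if "j < 0" for j
    using intensity that by (auto simp: intensity_parameters_def)
  have neg': "state_prob M N m t = 0" if "m < 0" for m
    using negative[of "- m" t] that assms by simp
  \<comment> \<open>Used for c = 0 and c = 1. For c = 1 the term j = 0 contains
    \<open>lam (-1) = 0\<close>, so both convolutions run over the same range and subtract
    termwise.\<close>
  have conv: "discrete_conv lam (\<lambda>m. state_prob M N m t) (int n - c) =
      (\<Sum>j=0..n. lam (int j - c) * state_prob M N (int (n - j)) t)" if "c \<ge> 0" for c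
  proof -
    have "discrete_conv lam (\<lambda>m. state_prob M N m t) (int n - c) =
        (\<Sum>\<^sub>\<infinity>j\<in>(\<lambda>j. int j - c) ` {0..n}. lam j * state_prob M N (int n - c - j) t)"
      unfolding discrete_conv_def
    proof (rule infsum_cong_neutral)
      fix j assume j: "j \<in> UNIV - (\<lambda>j. int j - c) ` {0..n}"
      have "j < - c \<or> j > int n - c"
      proof (rule ccontr)
        assume "\<not> ?thesis"
        then have "j = int (nat (j + c)) - c" "nat (j + c) \<in> {0..n}" by auto
        then show False using j by blast
      qed
      then show "lam j * state_prob M N (int n - c - j) t = 0"
        using neg[of j] neg'[of "int n - c - j"] that by auto
    qed auto
    also have "\<dots> = (\<Sum>j\<in>(\<lambda>j. int j - c) ` {0..n}. lam j * state_prob M N (int n - c - j) t)"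
      by (rule infsum_finite) simp
    also have "\<dots> = (\<Sum>j=0..n. lam (int j - c) * state_prob M N (int (n - j)) t)"
      by (subst sum.reindex) (auto simp: inj_on_def of_nat_diff intro!: sum.cong)
    finally show ?thesis .
  qed
  show ?thesis
    using conv[of 0] conv[of 1]
    by (simp add: jump_rate_def left_diff_distrib sum_subtractf)
qed

lemma state_prob_integral_equation:
  assumes "t > 0"
  shows "state_prob M N (int n) t = (if n = 0 then 1 else 0) +
    frac_int \<alpha> (\<lambda>s. \<Sum>j=0..n. jump_rate lam j * state_prob M N (int (n - j)) s) t"
proof -
  have "state_prob M N (int n) t - state_prob M N (int n) 0 =
    frac_int \<alpha> (\<lambda>s. \<Sum>j=0..n. jump_rate lam j * state_prob M N (int (n - j)) s) t"
  proof (rule caputo_imp_integral_equation)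
    show "continuous_on {0..t} (\<lambda>s. \<Sum>j=0..n. jump_rate lam j * state_prob M N (int (n - j)) s)"
    proof (intro continuous_intros)
      show "continuous_on {0..t} (state_prob M N (int (n - j)))" for j
        using regular[of "int (n - j)"]
        by (auto simp: caputo_differentiable_def simp del: of_nat_diff elim: continuous_on_subset)
    qed
    show "caputo_deriv \<alpha> (state_prob M N (int n)) s =
        (\<Sum>j=0..n. jump_rate lam j * state_prob M N (int (n - j)) s)" if "0 < s" for s
      using evolution[of "int n" s] state_equation_rhs[of s n] that by simp
  qed (use order regular assms in auto)
  moreover have "state_prob M N (int n) 0 = (if n = 0 then 1 else 0)"
    using initial_zero initial_pos[of "int n"] by auto
  ultimately show ?thesis by simp
qed

lemma has_bochner_integral_moment:
  assumes "t > 0"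
  shows "has_bochner_integral M (\<lambda>\<omega>. real (N t \<omega>) ^ r)
    (fact r * (\<Sum>k\<le>r. frac_monomial \<alpha> k t * fps_nth (moment_fps (Abs_fps (jump_rate lam)) ^ k) r))"
proof (rule has_bochner_integral_nat_valued)
  obtain w where w: "w > 1" "summable (\<lambda>j. \<bar>jump_rate lam j\<bar> * w ^ j)"
    using jump_rate_summable_geometric[OF intensity] .
  have "(\<lambda>n. real n ^ r * state_prob M N (int n) t) sums
      (fact r * (\<Sum>k\<le>r. frac_monomial \<alpha> k t * fps_nth (moment_fps (Abs_fps (jump_rate lam)) ^ k) r))"
  proof (rule convolution_equation_moment_sums)
    show "continuous_on {0..} (state_prob M N (int n))" for n
      using regular[of "int n"] by (simp add: caputo_differentiable_def)
    show "\<bar>state_prob M N (int n) t\<bar> \<le> 1" for n t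
      by (simp add: state_prob_def)
    show "state_prob M N (int n) t = (if n = 0 then 1 else 0) +
        frac_int \<alpha> (\<lambda>s. \<Sum>j=0..n. fps_nth (Abs_fps (jump_rate lam)) j * state_prob M N (int (n - j)) s) t"
      if "t > 0" for n t
      using state_prob_integral_equation[OF that] by simp
  qed (use order w suminf_jump_rate[OF intensity] assms in auto)
  then show "(\<lambda>n. real n ^ r * prob {\<omega> \<in> space M. N t \<omega> = n}) sums
      (fact r * (\<Sum>k\<le>r. frac_monomial \<alpha> k t * fps_nth (moment_fps (Abs_fps (jump_rate lam)) ^ k) r))"
    by (simp add: state_prob_def)
qed (use random_variable assms in auto)

text \<open>The integral equation is stated for t > 0, so the moments at t = 0 come from the initial
  condition.\<close>

lemma AE_initial: "AE \<omega> in M. N 0 \<omega> = 0"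
proof -
  have [measurable]: "N 0 \<in> measurable M (count_space UNIV)"
    by (rule random_variable) simp
  have "prob {\<omega> \<in> space M. N 0 \<omega> = 0} = 1"
    using initial_zero by (simp add: state_prob_def)
  then show ?thesis
    by (subst (asm) prob_Collect_eq_1) auto
qed

end

text \<open>Integrability is asserted with the value, since the integral of a non-integrable
  function is 0 by convention. Compositions are extensional functions, so each is counted
  once.\<close>

theorem proposition3p5:
  fixes M :: "'a measure" and \<alpha> :: real and lam :: "int \<Rightarrow> real"
    and N :: "real \<Rightarrow> 'a \<Rightarrow> nat" and r :: nat and t :: real
  assumes "convoluted_fractional_poisson M \<alpha> lam N"
    and "r \<ge> 1" and "t \<ge> 0"
  shows "integrable M (\<lambda>\<omega>. real (N t \<omega>) ^ r) \<and>
    integral\<^sup>L M (\<lambda>\<omega>. real (N t \<omega>) ^ r) =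
      fact r * (\<Sum>k=1..r. t powr (real k * \<alpha>) / Gamma (real k * \<alpha> + 1) *
        (\<Sum>m \<in> {m \<in> {1..k} \<rightarrow>\<^sub>E (UNIV :: nat set). (\<Sum>l=1..k. m l) = r}.
          \<Prod>l=1..k. (1 / fact (m l) *
            (\<Sum>j::nat. real j ^ m l * (lam (int j - 1) - lam (int j))))))"
proof -
  interpret convoluted_fractional_poisson M \<alpha> lam N by fact
  show ?thesis
  proof (cases "t = 0")
    case True
    have "has_bochner_integral M (\<lambda>\<omega>. real (N 0 \<omega>) ^ r) 0 \<longleftrightarrow> has_bochner_integral M (\<lambda>\<omega>. 0 :: real) 0"
    proof (rule has_bochner_integral_cong_AE)
      have "N 0 \<in> measurable M (count_space UNIV)"
        by (rule random_variable) simp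
      then show "(\<lambda>\<omega>. real (N 0 \<omega>) ^ r) \<in> borel_measurable M"
        by measurable
      show "AE \<omega> in M. real (N 0 \<omega>) ^ r = 0"
        using AE_initial \<open>r \<ge> 1\<close> by (auto elim!: eventually_mono)
    qed simp
    then have "has_bochner_integral M (\<lambda>\<omega>. real (N t \<omega>) ^ r) 0"
      using True by (simp add: has_bochner_integral_zero)
    \<comment> \<open>At t = 0 every term of the right-hand side vanishes, again by
      \<open>0 powr y = 0\<close>.\<close>
    then show ?thesis
      using True by (simp add: has_bochner_integral_iff)
  next
    case False
    then have "t > 0" using \<open>t \<ge> 0\<close> by simp
    \<comment> \<open>The term k = 0 drops out because the constant series 1 has coefficient 0 at r
      \<ge> 1.\<close>
    have "(\<Sum>k\<le>r. frac_monomial \<alpha> k t * fps_nth (moment_fps (Abs_fps (jump_rate lam)) ^ k) r) =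
        (\<Sum>k=1..r. frac_monomial \<alpha> k t * fps_nth (moment_fps (Abs_fps (jump_rate lam)) ^ k) r)"
      using \<open>r \<ge> 1\<close> by (intro sum.mono_neutral_right) (auto simp: not_le)
    then show ?thesis
      using has_bochner_integral_moment[OF \<open>t > 0\<close>, of r]
      by (simp add: has_bochner_integral_iff fps_power_nth_PiE moment_fps_def frac_monomial_def jump_rate_def)
  qed
qed

end
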